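(* Let $A$ be a Banach algebra. If $A^{***}A^{**}\subseteq A^*$ and $A^{**}$ is weakly amenable, then $A$ is weakly amenable.
   Context: $A^{**}$ is a Banach algebra under the first Arens product: $\langle b''a',a\rangle=\langle b'',a'a\rangle$ and $\langle a''b'',a'\rangle=\langle a'',b''a'\rangle$, where $\langle a'a,b\rangle=\langle a',ab\rangle$ ($a,b\in A$, $a'\in A^*$, $a'',b''\in A^{**}$). For $a'''\in A^{***}$, $a''\in A^{**}$, the product $a'''a''\in A^{***}$ is defined by $\langle a'''a'',b''\rangle=\langle a''',a''b''\rangle$ for $b''\in A^{**}$; $A^{***}A^{**}$ is the set of all such products, and $A^*$ is regarded as a subspace of $A^{***}$ via the canonical embedding. A Banach algebra $B$ is weakly amenable if every derivation (bounded linear $D:B\to B^*$ with $D(xy)=xD(y)+D(x)y$) is inner, i.e. of the form $a\mapsto ax-xa$ for some $x\in B^*$, where $B^*$ has the dual bimodule actions $\langle a'a,b\rangle=\langle a',ab\rangle$, $\langle aa',b\rangle=\langle a',ba\rangle$. *)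

theory Defs
  imports "HOL-Analysis.Analysis" "HOL-Library.Function_Algebras"
begin

text \<open>
  Everything is stated over a complete normed field \<open>'k :: {real_normed_field, banach}\<close>. By the
  theorems of Gelfand--Mazur and Frobenius such a field is (isomorphic to) the reals or the complex
  numbers, so real and complex Banach algebras are covered simultaneously.

  The library dual \<open>'a \<Rightarrow>\<^sub>L real\<close> only consists of real-linear functionals, and there is no type
  of bounded \<open>'k\<close>-linear functionals. Dual spaces are therefore explicit sets of functions.
\<close>

locale banach_algebra_over = vector_space scale
  for scale :: "'k::{real_normed_field, banach} \<Rightarrow> 'a::{real_normed_algebra, banach} \<Rightarrow> 'a" +
  assumes scale_of_real: "scale (of_real r) x = r *\<^sub>R x"
    and norm_scale: "norm (scale k x) = norm k * norm x"
    and scale_mult_left: "scale k x * y = scale k (x * y)"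
    and scale_mult_right: "x * scale k y = scale k (x * y)"

lemma banach_algebra_over_real:
  "banach_algebra_over ((*\<^sub>R) :: real \<Rightarrow> 'a::{real_normed_algebra, banach} \<Rightarrow> 'a)"
  by unfold_locales (auto simp: algebra_simps)

lemma banach_algebra_over_complex:
  "banach_algebra_over ((*) :: complex \<Rightarrow> complex \<Rightarrow> complex)"
  by unfold_locales (auto simp: algebra_simps norm_mult scaleR_conv_of_real)


text \<open>
  A normed space is a subspace \<open>pts\<close> of an abelian group type, with its own scalar multiplication
  and norm; addition is that of the type.
\<close>

record ('k, 'v) normed_sp =
  pts :: "'v set"
  smul :: "'k \<Rightarrow> 'v \<Rightarrow> 'v"
  nrm :: "'v \<Rightarrow> real"

record ('k, 'v) normed_alg = "('k, 'v) normed_sp" +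
  mul :: "'v \<Rightarrow> 'v \<Rightarrow> 'v"

definition alg_of :: "('k::{real_normed_field, banach} \<Rightarrow> 'a::{real_normed_algebra, banach} \<Rightarrow> 'a)
    \<Rightarrow> ('k, 'a) normed_alg" where
  "alg_of sc = \<lparr>pts = UNIV, smul = sc, nrm = norm, mul = (*)\<rparr>"

definition scalars :: "('k::{real_normed_field, banach}, 'k) normed_sp" where
  "scalars = \<lparr>pts = UNIV, smul = (*), nrm = norm\<rparr>"

definition bounded_lin :: "('k, 'v::ab_group_add, 'm) normed_sp_scheme
    \<Rightarrow> ('k, 'w::ab_group_add, 'n) normed_sp_scheme \<Rightarrow> ('v \<Rightarrow> 'w) \<Rightarrow> bool" where
  "bounded_lin X Y T \<longleftrightarrow>
     (\<forall>x\<in>pts X. T x \<in> pts Y) \<and>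
     (\<forall>x\<in>pts X. \<forall>y\<in>pts X. T (x + y) = T x + T y) \<and>
     (\<forall>k. \<forall>x\<in>pts X. T (smul X k x) = smul Y k (T x)) \<and>
     (\<exists>C. \<forall>x\<in>pts X. nrm Y (T x) \<le> C * nrm X x)"

text \<open>
  A functional on \<open>X\<close> is represented by the function that vanishes outside \<open>pts X\<close>, so that
  equality of functionals is equality of functions and the vector space operations are pointwise.
\<close>

definition cut :: "'v set \<Rightarrow> ('v \<Rightarrow> 'k::zero) \<Rightarrow> 'v \<Rightarrow> 'k" where
  "cut V f = (\<lambda>x. if x \<in> V then f x else 0)"

definition dual :: "('k::{real_normed_field, banach}, 'v::ab_group_add, 'm) normed_sp_scheme
    \<Rightarrow> ('k, 'v \<Rightarrow> 'k) normed_sp" where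
  "dual X =
     \<lparr>pts = {f. bounded_lin X scalars f \<and> (\<forall>x. x \<notin> pts X \<longrightarrow> f x = 0)},
      smul = (\<lambda>k f x. k * f x),
      nrm = (\<lambda>f. SUP x\<in>{x \<in> pts X. nrm X x \<le> 1}. norm (f x))\<rparr>"

definition canon :: "('k::{real_normed_field, banach}, 'v::ab_group_add, 'm) normed_sp_scheme
    \<Rightarrow> 'v \<Rightarrow> ('v \<Rightarrow> 'k) \<Rightarrow> 'k" where
  "canon X x = cut (pts (dual X)) (\<lambda>f. f x)"


text \<open>The dual bimodule actions: \<open>rmod B f a\<close> is $f\,a$ and \<open>lmod B a f\<close> is $a\,f$.\<close>

definition rmod :: "('k::{real_normed_field, banach}, 'v::ab_group_add) normed_alg
    \<Rightarrow> ('v \<Rightarrow> 'k) \<Rightarrow> 'v \<Rightarrow> ('v \<Rightarrow> 'k)" where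
  "rmod B f a = cut (pts B) (\<lambda>b. f (mul B a b))"

definition lmod :: "('k::{real_normed_field, banach}, 'v::ab_group_add) normed_alg
    \<Rightarrow> 'v \<Rightarrow> ('v \<Rightarrow> 'k) \<Rightarrow> ('v \<Rightarrow> 'k)" where
  "lmod B a f = cut (pts B) (\<lambda>b. f (mul B b a))"

definition derivation :: "('k::{real_normed_field, banach}, 'v::ab_group_add) normed_alg
    \<Rightarrow> ('v \<Rightarrow> ('v \<Rightarrow> 'k)) \<Rightarrow> bool" where
  "derivation B D \<longleftrightarrow>
     bounded_lin B (dual B) D \<and>
     (\<forall>x\<in>pts B. \<forall>y\<in>pts B. D (mul B x y) = lmod B x (D y) + rmod B (D x) y)"

definition inner_derivation :: "('k::{real_normed_field, banach}, 'v::ab_group_add) normed_alg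
    \<Rightarrow> ('v \<Rightarrow> ('v \<Rightarrow> 'k)) \<Rightarrow> bool" where
  "inner_derivation B D \<longleftrightarrow>
     (\<exists>f\<in>pts (dual B). \<forall>a\<in>pts B. D a = lmod B a f - rmod B f a)"

definition weakly_amenable ::
    "('k::{real_normed_field, banach}, 'v::ab_group_add) normed_alg \<Rightarrow> bool" where
  "weakly_amenable B \<longleftrightarrow> (\<forall>D. derivation B D \<longrightarrow> inner_derivation B D)"


text \<open>\<open>bidual_act A G f\<close> is the functional $b''a'$ for \<open>G\<close> $= b''$ and \<open>f\<close> $= a'$.\<close>

definition bidual_act :: "('k::{real_normed_field, banach}, 'v::ab_group_add) normed_alg
    \<Rightarrow> (('v \<Rightarrow> 'k) \<Rightarrow> 'k) \<Rightarrow> ('v \<Rightarrow> 'k) \<Rightarrow> ('v \<Rightarrow> 'k)" where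
  "bidual_act A G f = cut (pts A) (\<lambda>a. G (rmod A f a))"

definition first_arens :: "('k::{real_normed_field, banach}, 'v::ab_group_add) normed_alg
    \<Rightarrow> (('v \<Rightarrow> 'k) \<Rightarrow> 'k) \<Rightarrow> (('v \<Rightarrow> 'k) \<Rightarrow> 'k) \<Rightarrow> (('v \<Rightarrow> 'k) \<Rightarrow> 'k)" where
  "first_arens A F G = cut (pts (dual A)) (\<lambda>f. F (bidual_act A G f))"

definition bidual_alg :: "('k::{real_normed_field, banach}, 'v::ab_group_add) normed_alg
    \<Rightarrow> ('k, ('v \<Rightarrow> 'k) \<Rightarrow> 'k) normed_alg" where
  "bidual_alg A =
     \<lparr>pts = pts (dual (dual A)), smul = smul (dual (dual A)), nrm = nrm (dual (dual A)),
      mul = first_arens A\<rparr>"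

end

theory Submission
  imports Defs
begin

text \<open>
  Let \<open>D\<close> be a derivation from \<open>A\<close> to its dual. Its second transpose \<open>D''\<close>, given by
  \<open>D'' F G = F (a \<mapsto> G (D a))\<close>, is a bounded linear map from the bidual to the third dual and
  extends \<open>D\<close> along the canonical embeddings. The point is that \<open>D''\<close> is again a derivation, now
  for the first Arens product. Expanding \<open>D (a b)\<close> by the Leibniz rule inside \<open>D'' (F G) H\<close> gives
  the sum of \<open>D'' F (G H)\<close>, as required, and of \<open>F\<close> applied to the functional
  \<open>a \<mapsto> D'' G (H a)\<close>. The latter should be \<open>D'' G (H F)\<close>. This fails in general, since the first
  Arens product need not be weak-star continuous in its second factor; but by hypothesis the product
  \<open>(D'' G) H\<close> is evaluation at some functional \<open>f\<close> on \<open>A\<close>, so that \<open>a \<mapsto> D'' G (H a)\<close> is \<open>f\<close> and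
  both expressions equal \<open>F f\<close> (lemma \<open>second_transpose_derivation\<close>).

  Weak amenability of the bidual then yields \<open>T\<close> in the third dual with \<open>D'' F = F T - T F\<close>.
  As \<open>D''\<close> extends \<open>D\<close> and the Arens product extends the product of \<open>A\<close>, the restriction of \<open>T\<close>
  to \<open>A\<close> implements \<open>D\<close> as an inner derivation.
\<close>

section \<open>Duals and transposes\<close>

text \<open>
  These axioms are chosen to be inherited by duals and to suffice for
  \<open>norm (f x) \<le> nrm (dual X) f * nrm X x\<close>: rescaling a vector into the unit ball takes just the
  inequality form of homogeneity. Hence biduals and third duals need no separate treatment.
\<close>

locale homogeneous_normed_space =
  fixes X :: "('k::{real_normed_field, banach}, 'v::ab_group_add, 'm) normed_sp_scheme"
  assumes zero_pts: "0 \<in> pts X"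
    and add_pts: "x \<in> pts X \<Longrightarrow> y \<in> pts X \<Longrightarrow> x + y \<in> pts X"
    and smul_pts: "x \<in> pts X \<Longrightarrow> smul X k x \<in> pts X"
    and nrm_zero: "nrm X 0 = 0"
    and nrm_nonneg: "x \<in> pts X \<Longrightarrow> 0 \<le> nrm X x"
    and nrm_smul_le: "x \<in> pts X \<Longrightarrow> nrm X (smul X k x) \<le> norm k * nrm X x"

lemma bounded_linD:
  assumes "bounded_lin X Y T"
  shows "x \<in> pts X \<Longrightarrow> T x \<in> pts Y"
    and "x \<in> pts X \<Longrightarrow> y \<in> pts X \<Longrightarrow> T (x + y) = T x + T y"
    and "x \<in> pts X \<Longrightarrow> T (smul X k x) = smul Y k (T x)"
  using assms by (auto simp: bounded_lin_def)

lemma (in homogeneous_normed_space) bounded_lin_bound: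
  assumes "bounded_lin X Y T"
  obtains C where "0 \<le> C" "\<And>x. x \<in> pts X \<Longrightarrow> nrm Y (T x) \<le> C * nrm X x"
proof -
  obtain C where C: "\<And>x. x \<in> pts X \<Longrightarrow> nrm Y (T x) \<le> C * nrm X x"
    using assms unfolding bounded_lin_def by blast
  have "nrm Y (T x) \<le> max C 0 * nrm X x" if "x \<in> pts X" for x
    using C[OF that] nrm_nonneg[OF that] mult_right_mono[of C "max C 0" "nrm X x"] by linarith
  then show thesis using that[of "max C 0"] by simp
qed

lemma smul_dual [simp]: "smul (dual X) k f = (\<lambda>x. k * f x)"
  by (simp add: dual_def)

lemma dualD:
  assumes "f \<in> pts (dual X)"
  shows "x \<in> pts X \<Longrightarrow> y \<in> pts X \<Longrightarrow> f (x + y) = f x + f y"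
    and "x \<in> pts X \<Longrightarrow> f (smul X k x) = k * f x"
    and "x \<notin> pts X \<Longrightarrow> f x = 0"
    and "bounded_lin X scalars f"
  using assms by (auto simp: dual_def bounded_lin_def scalars_def)

context homogeneous_normed_space
begin

lemma cut_in_dual:
  assumes "\<And>x y. x \<in> pts X \<Longrightarrow> y \<in> pts X \<Longrightarrow> f (x + y) = f x + f y"
    and "\<And>k x. x \<in> pts X \<Longrightarrow> f (smul X k x) = k * f x"
    and "\<And>x. x \<in> pts X \<Longrightarrow> norm (f x) \<le> C * nrm X x"
  shows "cut (pts X) f \<in> pts (dual X)"
proof -
  have "\<exists>C. \<forall>x\<in>pts X. norm (f x) \<le> C * nrm X x"
    using assms(3) by blast
  then show ?thesis
    using assms(1,2) by (simp add: dual_def bounded_lin_def scalars_def cut_def add_pts smul_pts)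
qed

lemma functional_zero: "f \<in> pts (dual X) \<Longrightarrow> f 0 = 0"
  using dualD(1)[of f X 0 0] zero_pts by simp

lemma nrm_dual_le:
  assumes "0 \<le> C" "\<And>x. x \<in> pts X \<Longrightarrow> norm (f x) \<le> C * nrm X x"
  shows "nrm (dual X) f \<le> C"
proof -
  have "norm (f x) \<le> C" if "x \<in> pts X" "nrm X x \<le> 1" for x
    using assms(2)[OF that(1)] mult_left_mono[OF that(2) assms(1)] by simp
  moreover have "0 \<in> {x \<in> pts X. nrm X x \<le> 1}" by (simp add: zero_pts nrm_zero)
  ultimately show ?thesis unfolding dual_def by (auto intro!: cSUP_least)
qed

lemma unit_ball_le_nrm_dual:
  assumes f: "f \<in> pts (dual X)" and x: "x \<in> pts X" "nrm X x \<le> 1"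
  shows "norm (f x) \<le> nrm (dual X) f"
proof -
  obtain C where C: "0 \<le> C" "\<And>x. x \<in> pts X \<Longrightarrow> norm (f x) \<le> C * nrm X x"
    using bounded_lin_bound[OF dualD(4)[OF f]] by (auto simp: scalars_def)
  have "norm (f y) \<le> C" if "y \<in> pts X" "nrm X y \<le> 1" for y
    using C(2)[OF that(1)] mult_left_mono[OF that(2) C(1)] by simp
  then have "bdd_above ((\<lambda>x. norm (f x)) ` {x \<in> pts X. nrm X x \<le> 1})"
    by (auto intro!: bdd_aboveI[where M = C])
  with x show ?thesis unfolding dual_def by (auto intro: cSUP_upper)
qed

lemma nrm_dual_nonneg: "f \<in> pts (dual X) \<Longrightarrow> 0 \<le> nrm (dual X) f"
  using unit_ball_le_nrm_dual[of f 0] by (simp add: zero_pts nrm_zero functional_zero)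

lemma norm_le_nrm_dual:
  assumes f: "f \<in> pts (dual X)" and x: "x \<in> pts X"
  shows "norm (f x) \<le> nrm (dual X) f * nrm X x"
proof (cases "nrm X x = 0")
  case True
  then show ?thesis using bounded_lin_bound[OF dualD(4)[OF f]] x
    by (metis mult_zero_right normed_sp.select_convs(3) scalars_def)
next
  case False
  then have pos: "0 < nrm X x" using nrm_nonneg[OF x] by simp
  define k :: 'k where "k = of_real (1 / nrm X x)"
  have nk: "norm k = 1 / nrm X x" using pos by (simp only: k_def norm_of_real) simp
  have "nrm X (smul X k x) \<le> 1" using nrm_smul_le[OF x, of k] pos by (simp add: nk)
  then have "norm (f (smul X k x)) \<le> nrm (dual X) f"
    by (intro unit_ball_le_nrm_dual f smul_pts x)
  then show ?thesis using pos by (simp add: dualD(2)[OF f x] norm_mult nk field_simps)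
qed

lemma homogeneous_normed_space_dual: "homogeneous_normed_space (dual X)"
proof
  show "0 \<in> pts (dual X)"
    using cut_in_dual[of "\<lambda>_. 0" 0] by (simp add: cut_def zero_fun_def)
  show "f + g \<in> pts (dual X)" if f: "f \<in> pts (dual X)" and g: "g \<in> pts (dual X)" for f g
  proof -
    have "norm (f x + g x) \<le> (nrm (dual X) f + nrm (dual X) g) * nrm X x" if "x \<in> pts X" for x
      using norm_triangle_ineq[of "f x" "g x"] norm_le_nrm_dual[OF f that] norm_le_nrm_dual[OF g that]
      by (simp add: algebra_simps)
    then have "cut (pts X) (\<lambda>x. f x + g x) \<in> pts (dual X)"
      by (intro cut_in_dual[where C = "nrm (dual X) f + nrm (dual X) g"]) (auto simp: dualD[OF f] dualD[OF g] algebra_simps)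
    also have "cut (pts X) (\<lambda>x. f x + g x) = f + g"
      by (auto simp: cut_def dualD(3)[OF f] dualD(3)[OF g])
    finally show ?thesis .
  qed
  show smul: "smul (dual X) k f \<in> pts (dual X)" if f: "f \<in> pts (dual X)" for k f
  proof -
    have "norm (k * f x) \<le> (norm k * nrm (dual X) f) * nrm X x" if "x \<in> pts X" for x
      using mult_left_mono[OF norm_le_nrm_dual[OF f that], of "norm k"]
      by (simp add: norm_mult mult.assoc)
    then have "cut (pts X) (\<lambda>x. k * f x) \<in> pts (dual X)"
      by (intro cut_in_dual[where C = "norm k * nrm (dual X) f"]) (auto simp: dualD[OF f] algebra_simps)
    also have "cut (pts X) (\<lambda>x. k * f x) = smul (dual X) k f"
      by (auto simp: cut_def dualD(3)[OF f])
    finally show ?thesis .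
  qed
  show "nrm (dual X) 0 = 0"
    using nrm_dual_le[of 0 0] nrm_dual_nonneg[OF \<open>0 \<in> pts (dual X)\<close>] by simp
  show "0 \<le> nrm (dual X) f" if "f \<in> pts (dual X)" for f
    using that by (rule nrm_dual_nonneg)
  show "nrm (dual X) (smul (dual X) k f) \<le> norm k * nrm (dual X) f"
    if f: "f \<in> pts (dual X)" for k f
    using nrm_dual_nonneg[OF f] norm_le_nrm_dual[OF f]
    by (intro nrm_dual_le) (auto simp: norm_mult mult.assoc intro: mult_left_mono)
qed

lemma canon_in_bidual:
  assumes "x \<in> pts X"
  shows "canon X x \<in> pts (dual (dual X))"
proof -
  interpret X': homogeneous_normed_space "dual X" by (rule homogeneous_normed_space_dual)
  show ?thesis unfolding canon_def
    using norm_le_nrm_dual[OF _ assms]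
    by (intro X'.cut_in_dual[where C = "nrm X x"]) (auto simp: mult.commute)
qed

end

definition transpose_map :: "('k::{real_normed_field, banach}, 'v::ab_group_add, 'm) normed_sp_scheme
    \<Rightarrow> ('v \<Rightarrow> 'w) \<Rightarrow> ('w \<Rightarrow> 'k) \<Rightarrow> 'v \<Rightarrow> 'k" where
  "transpose_map X T g = cut (pts X) (\<lambda>x. g (T x))"

text \<open>
  Both the action of the bidual on the dual and the first Arens product are transposes, which
  is why one boundedness lemma serves these two and the second transpose of a derivation.
\<close>

lemma bounded_lin_transpose:
  assumes X: "homogeneous_normed_space X" and Y: "homogeneous_normed_space Y"
    and T: "bounded_lin X Y T"
  shows "bounded_lin (dual Y) (dual X) (transpose_map X T)"
proof -
  interpret X: homogeneous_normed_space X by fact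
  interpret Y: homogeneous_normed_space Y by fact
  obtain C where C: "0 \<le> C" "\<And>x. x \<in> pts X \<Longrightarrow> nrm Y (T x) \<le> C * nrm X x"
    using X.bounded_lin_bound[OF T] by blast
  have bound: "norm (g (T x)) \<le> (C * nrm (dual Y) g) * nrm X x"
    if g: "g \<in> pts (dual Y)" and x: "x \<in> pts X" for g x
    using Y.norm_le_nrm_dual[OF g bounded_linD(1)[OF T x]]
      mult_left_mono[OF C(2)[OF x] Y.nrm_dual_nonneg[OF g]]
    by (simp add: mult_ac)
  have "transpose_map X T g \<in> pts (dual X)" if g: "g \<in> pts (dual Y)" for g
    unfolding transpose_map_def using bound[OF g]
    by (intro X.cut_in_dual[where C = "C * nrm (dual Y) g"]) (auto simp: bounded_linD[OF T] dualD[OF g])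
  moreover have "nrm (dual X) (transpose_map X T g) \<le> C * nrm (dual Y) g"
    if g: "g \<in> pts (dual Y)" for g
    using bound[OF g] C(1) Y.nrm_dual_nonneg[OF g]
    by (intro X.nrm_dual_le) (auto simp: transpose_map_def cut_def)
  ultimately show ?thesis
    by (auto simp: bounded_lin_def transpose_map_def cut_def)
qed

section \<open>The bidual algebra\<close>

lemma pts_bidual_alg [simp]: "pts (bidual_alg A) = pts (dual (dual A))"
  and mul_bidual_alg [simp]: "mul (bidual_alg A) = first_arens A"
  by (simp_all add: bidual_alg_def)

lemma dual_bidual_alg [simp]: "dual (bidual_alg A) = dual (dual (dual A))"
  by (simp add: dual_def bidual_alg_def bounded_lin_def)

lemma bounded_lin_bidual_alg [simp]:
  "bounded_lin (bidual_alg A) Y T \<longleftrightarrow> bounded_lin (dual (dual A)) Y T"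
  by (simp add: bidual_alg_def bounded_lin_def)

lemma bidual_act_eq_transpose: "bidual_act A G f = transpose_map A (rmod A f) G"
  by (simp add: bidual_act_def transpose_map_def)

lemma first_arens_eq_transpose: "first_arens A F G = transpose_map (dual A) (bidual_act A G) F"
  by (simp add: first_arens_def transpose_map_def)

lemma alg_of_simps [simp]:
  "pts (alg_of sc) = UNIV" "smul (alg_of sc) = sc" "nrm (alg_of sc) = norm" "mul (alg_of sc) = (*)"
  by (simp_all add: alg_of_def)

lemma cut_UNIV [simp]: "cut UNIV f = f"
  by (simp add: cut_def)

context banach_algebra_over
begin

abbreviation "A \<equiv> alg_of scale"

sublocale A: homogeneous_normed_space A
  by standard (auto simp: norm_scale)

sublocale A': homogeneous_normed_space "dual A"
  by (rule A.homogeneous_normed_space_dual)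

sublocale A'': homogeneous_normed_space "dual (dual A)"
  by (rule A'.homogeneous_normed_space_dual)

lemma functional_simps:
  assumes "f \<in> pts (dual A)"
  shows "f (x + y) = f x + f y" "f (scale k x) = k * f x"
  using dualD[OF assms] by auto

lemma norm_functional_mult_le:
  assumes "f \<in> pts (dual A)"
  shows "norm (f (a * b)) \<le> nrm (dual A) f * norm a * norm b"
  using A.norm_le_nrm_dual[OF assms, of "a * b"]
    mult_left_mono[OF norm_mult_ineq[of a b] A.nrm_dual_nonneg[OF assms]]
  by (simp add: mult.assoc)

lemma bounded_lin_rmod:
  assumes f: "f \<in> pts (dual A)"
  shows "bounded_lin A (dual A) (rmod A f)"
proof -
  have "rmod A f a \<in> pts (dual A)" for a
    unfolding rmod_def using norm_functional_mult_le[OF f, of a]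
    by (intro A.cut_in_dual[where C = "nrm (dual A) f * norm a"])
      (auto simp: functional_simps[OF f] distrib_left scale_mult_right)
  moreover have "nrm (dual A) (rmod A f a) \<le> nrm (dual A) f * norm a" for a
    using norm_functional_mult_le[OF f, of a] A.nrm_dual_nonneg[OF f]
    by (intro A.nrm_dual_le) (auto simp: rmod_def)
  ultimately show ?thesis
    by (auto simp: bounded_lin_def rmod_def functional_simps[OF f] distrib_right scale_mult_left
        fun_eq_iff)
qed

lemma rmod_in_dual: "f \<in> pts (dual A) \<Longrightarrow> rmod A f a \<in> pts (dual A)"
  using bounded_linD(1)[OF bounded_lin_rmod] by simp

lemma lmod_in_dual:
  assumes f: "f \<in> pts (dual A)"
  shows "lmod A a f \<in> pts (dual A)"
  unfolding lmod_def using norm_functional_mult_le[OF f, of _ a]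
  by (intro A.cut_in_dual[where C = "nrm (dual A) f * norm a"])
    (auto simp: functional_simps[OF f] distrib_right scale_mult_left mult_ac)

lemma bidual_act_in_dual:
  assumes "G \<in> pts (dual (dual A))" "f \<in> pts (dual A)"
  shows "bidual_act A G f \<in> pts (dual A)"
  unfolding bidual_act_eq_transpose
  by (rule bounded_linD(1)[OF bounded_lin_transpose[OF A.homogeneous_normed_space_axioms
          A'.homogeneous_normed_space_axioms bounded_lin_rmod[OF assms(2)]] assms(1)])

lemma bounded_lin_bidual_act:
  assumes G: "G \<in> pts (dual (dual A))"
  shows "bounded_lin (dual A) (dual A) (bidual_act A G)"
proof -
  have bound: "norm (G (rmod A f a)) \<le> (nrm (dual (dual A)) G * nrm (dual A) f) * norm a"
    if f: "f \<in> pts (dual A)" for f a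
  proof -
    have "nrm (dual A) (rmod A f a) \<le> nrm (dual A) f * norm a"
      using norm_functional_mult_le[OF f, of a] A.nrm_dual_nonneg[OF f]
      by (intro A.nrm_dual_le) (auto simp: rmod_def)
    from mult_left_mono[OF this A'.nrm_dual_nonneg[OF G]] show ?thesis
      using A'.norm_le_nrm_dual[OF G rmod_in_dual[OF f], of a] by (simp add: mult.assoc)
  qed
  have "nrm (dual A) (bidual_act A G f) \<le> nrm (dual (dual A)) G * nrm (dual A) f"
    if f: "f \<in> pts (dual A)" for f
    using bound[OF f] A.nrm_dual_nonneg[OF f] A'.nrm_dual_nonneg[OF G]
    by (intro A.nrm_dual_le) (auto simp: bidual_act_def)
  moreover have "bidual_act A G (f + g) = bidual_act A G f + bidual_act A G g"
    if "f \<in> pts (dual A)" "g \<in> pts (dual A)" for f g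
  proof -
    have "rmod A (f + g) a = rmod A f a + rmod A g a" for a
      by (simp add: rmod_def fun_eq_iff)
    then show ?thesis
      by (intro ext) (simp add: bidual_act_def dualD(1)[OF G rmod_in_dual rmod_in_dual] that)
  qed
  moreover have "bidual_act A G (smul (dual A) k f) = smul (dual A) k (bidual_act A G f)"
    if "f \<in> pts (dual A)" for k f
  proof -
    have "rmod A (smul (dual A) k f) a = smul (dual A) k (rmod A f a)" for a
      by (simp add: rmod_def fun_eq_iff)
    then show ?thesis using dualD(2)[OF G rmod_in_dual[OF that], of k]
      by (intro ext) (simp add: bidual_act_def)
  qed
  ultimately show ?thesis
    using bidual_act_in_dual[OF G] unfolding bounded_lin_def by blast
qed

lemma first_arens_in_bidual:
  assumes "F \<in> pts (dual (dual A))" "G \<in> pts (dual (dual A))"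
  shows "first_arens A F G \<in> pts (dual (dual A))"
  unfolding first_arens_eq_transpose
  by (rule bounded_linD(1)[OF bounded_lin_transpose[OF A'.homogeneous_normed_space_axioms
          A'.homogeneous_normed_space_axioms bounded_lin_bidual_act[OF assms(2)]] assms(1)])

lemma canon_apply: "f \<in> pts (dual A) \<Longrightarrow> canon A a f = f a"
  by (simp add: canon_def cut_def)

lemma first_arens_apply: "f \<in> pts (dual A) \<Longrightarrow> first_arens A F G f = F (bidual_act A G f)"
  by (simp add: first_arens_def cut_def)

lemma canon_in_bidual_A: "canon A a \<in> pts (dual (dual A))"
  by (simp add: A.canon_in_bidual)

lemma bidual_act_canon:
  assumes "f \<in> pts (dual A)"
  shows "bidual_act A (canon A a) f = lmod A a f"
  using rmod_in_dual[OF assms]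
  by (simp add: bidual_act_def lmod_def canon_apply) (simp add: rmod_def)

lemma first_arens_canon: "first_arens A (canon A a) (canon A b) = canon A (a * b)"
proof
  fix f
  show "first_arens A (canon A a) (canon A b) f = canon A (a * b) f"
  proof (cases "f \<in> pts (dual A)")
    case True
    then show ?thesis
      by (simp add: first_arens_apply bidual_act_canon canon_apply lmod_in_dual)
        (simp add: lmod_def)
  qed (simp add: first_arens_def canon_def cut_def)
qed

lemma canon_add: "canon A (a + b) = canon A a + canon A b"
  by (auto simp: canon_def cut_def functional_simps fun_eq_iff)

lemma canon_scale: "canon A (scale k a) = smul (dual (dual A)) k (canon A a)"
  by (auto simp: canon_def cut_def functional_simps fun_eq_iff)

lemma restrict_in_dual:
  assumes T: "T \<in> pts (dual (dual (dual A)))"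
  shows "(\<lambda>a. T (canon A a)) \<in> pts (dual A)"
proof -
  have "nrm (dual (dual A)) (canon A a) \<le> norm a" for a
    by (intro A'.nrm_dual_le)
      (use A.norm_le_nrm_dual[of _ a] in \<open>auto simp: canon_apply mult.commute\<close>)
  from mult_left_mono[OF this A''.nrm_dual_nonneg[OF T]]
  have bound: "norm (T (canon A a)) \<le> nrm (dual (dual (dual A))) T * norm a" for a
    using A''.norm_le_nrm_dual[OF T canon_in_bidual_A[of a]] order_trans by blast
  have "cut (pts A) (\<lambda>a. T (canon A a)) \<in> pts (dual A)"
    using bound dualD(1)[OF T canon_in_bidual_A canon_in_bidual_A]
      dualD(2)[OF T canon_in_bidual_A]
    by (intro A.cut_in_dual[where C = "nrm (dual (dual (dual A))) T"]) (auto simp: canon_add canon_scale)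
  then show ?thesis by simp
qed

section \<open>Second transposes of derivations\<close>

abbreviation "second_transpose D \<equiv> transpose_map (dual (dual A)) (transpose_map A D)"

lemma second_transpose_apply:
  "G \<in> pts (dual (dual A)) \<Longrightarrow> second_transpose D F G = F (\<lambda>a. G (D a))"
  by (simp add: transpose_map_def cut_def)

text \<open>
  Applying \<open>H\<close>, then \<open>G\<close>, then \<open>F\<close> to the Leibniz rule for \<open>D\<close> plays the part of the usual iterated
  weak-star limit over nets in \<open>A\<close> converging to \<open>G\<close> and \<open>F\<close>. The hypothesis on products is what
  allows the last step, \<open>F\<close> being moved inside \<open>D'' G (H F)\<close>.
\<close>

lemma second_transpose_derivation:
  assumes D: "derivation A D"
    and prod: "\<And>T F. T \<in> pts (dual (dual (dual A))) \<Longrightarrow> F \<in> pts (dual (dual A)) \<Longrightarrow>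
      rmod (bidual_alg A) T F \<in> canon (dual A) ` pts (dual A)"
  shows "derivation (bidual_alg A) (second_transpose D)"
proof -
  let ?D' = "\<lambda>H a. H (D a)" and ?D'' = "second_transpose D"
  have lin: "bounded_lin A (dual A) D"
    and leibniz: "D (a * b) = lmod A a (D b) + rmod A (D a) b" for a b
    using D by (auto simp: derivation_def)
  have Da: "D a \<in> pts (dual A)" for a using bounded_linD(1)[OF lin] by simp
  have lin': "bounded_lin (dual (dual A)) (dual A) (transpose_map A D)"
    by (rule bounded_lin_transpose[OF A.homogeneous_normed_space_axioms
          A'.homogeneous_normed_space_axioms lin])
  have lin'': "bounded_lin (dual (dual A)) (dual (dual (dual A))) ?D''"
    by (rule bounded_lin_transpose[OF A''.homogeneous_normed_space_axioms
          A'.homogeneous_normed_space_axioms lin'])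
  have D': "?D' H \<in> pts (dual A)" if "H \<in> pts (dual (dual A))" for H
    using bounded_linD(1)[OF lin' that] by (simp add: transpose_map_def)
  have "?D'' (first_arens A F G) H
      = lmod (bidual_alg A) F (?D'' G) H + rmod (bidual_alg A) (?D'' F) G H"
    if F: "F \<in> pts (dual (dual A))" and G: "G \<in> pts (dual (dual A))"
      and H: "H \<in> pts (dual (dual A))" for F G H
  proof -
    obtain f where f: "f \<in> pts (dual A)" "rmod (bidual_alg A) (?D'' G) H = canon (dual A) f"
      using prod[OF bounded_linD(1)[OF lin'' G] H] by blast
    \<comment> \<open>Taking \<open>K\<close> in \<open>A\<close> identifies \<open>f\<close> below; \<open>K = F\<close> then gives the module action of \<open>F\<close>.\<close>
    have f_apply: "?D'' G (first_arens A H K) = K f" if "K \<in> pts (dual (dual A))" for K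
      using fun_cong[OF f(2), of K] that by (simp add: rmod_def canon_def cut_def)
    note HG [simp] = first_arens_in_bidual[OF G H] first_arens_in_bidual[OF H F]
      first_arens_in_bidual[OF H canon_in_bidual_A]
    have "rmod A (?D' H) a = ?D' (first_arens A H (canon A a)) + bidual_act A H (D a)" for a
    proof
      fix b
      have "H (D (a * b)) = H (lmod A a (D b)) + H (rmod A (D a) b)"
        using dualD(1)[OF H lmod_in_dual[OF Da] rmod_in_dual[OF Da]] by (simp add: leibniz)
      then show "rmod A (?D' H) a b
          = (?D' (first_arens A H (canon A a)) + bidual_act A H (D a)) b"
        by (simp add: first_arens_apply[OF Da] bidual_act_canon[OF Da])
          (simp add: rmod_def bidual_act_def)
    qed
    then have "G (rmod A (?D' H) a)
        = ?D'' G (first_arens A H (canon A a)) + ?D' (first_arens A G H) a" for a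
      using dualD(1)[OF G D'[OF HG(3)] bidual_act_in_dual[OF H Da]]
      by (simp add: second_transpose_apply first_arens_apply[OF Da])
    then have "bidual_act A G (?D' H) = f + ?D' (first_arens A G H)"
      using f_apply[OF canon_in_bidual_A]
      by (simp add: bidual_act_def canon_apply[OF f(1)] fun_eq_iff)
    then have "F (bidual_act A G (?D' H)) = F f + F (?D' (first_arens A G H))"
      using dualD(1)[OF F f(1) D'[OF HG(1)]] by simp
    then show ?thesis
      using H HG f_apply[OF F]
      by (simp add: second_transpose_apply first_arens_apply[OF D'[OF H]] lmod_def rmod_def cut_def)
  qed
  moreover have "?D'' (first_arens A F G) H
      = lmod (bidual_alg A) F (?D'' G) H + rmod (bidual_alg A) (?D'' F) G H"
    if "H \<notin> pts (dual (dual A))" for F G H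
    using that by (simp add: transpose_map_def lmod_def rmod_def cut_def)
  ultimately show ?thesis
    using lin'' by (fastforce simp: derivation_def fun_eq_iff)
qed

text \<open>
  On canonical images \<open>second_transpose D\<close> is \<open>D\<close> and the Arens product is the product of \<open>A\<close>, so a
  functional implementing the former restricts to one implementing \<open>D\<close>.
\<close>

lemma inner_derivation_of_second_transpose:
  assumes D: "bounded_lin A (dual A) D"
    and inner: "inner_derivation (bidual_alg A) (second_transpose D)"
  shows "inner_derivation A D"
proof -
  obtain T where T: "T \<in> pts (dual (dual (dual A)))"
    and eq: "\<And>F. F \<in> pts (dual (dual A)) \<Longrightarrow>
      second_transpose D F = lmod (bidual_alg A) F T - rmod (bidual_alg A) T F"
    using inner by (auto simp: inner_derivation_def)
  define f where "f = (\<lambda>a. T (canon A a))"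
  have Da: "D a \<in> pts (dual A)" for a using bounded_linD(1)[OF D] by simp
  have "D a b = f (b * a) - f (a * b)" for a b
  proof -
    have "(\<lambda>x. canon A b (D x)) = (\<lambda>x. D x b)" by (simp add: canon_apply[OF Da])
    moreover have "(\<lambda>x. canon A b (D x)) \<in> pts (dual A)"
      using bounded_linD(1)[OF bounded_lin_transpose[OF A.homogeneous_normed_space_axioms
            A'.homogeneous_normed_space_axioms D] canon_in_bidual_A[of b]]
      by (simp add: transpose_map_def)
    ultimately have "D a b = second_transpose D (canon A a) (canon A b)"
      by (simp add: second_transpose_apply canon_in_bidual_A canon_apply)
    also have "\<dots> = f (b * a) - f (a * b)"
      by (simp add: eq canon_in_bidual_A lmod_def rmod_def cut_def first_arens_canon f_def)
    finally show ?thesis .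
  qed
  then have "D a = lmod A a f - rmod A f a" for a
    by (simp add: lmod_def rmod_def fun_eq_iff)
  then show ?thesis
    using restrict_in_dual[OF T] unfolding inner_derivation_def f_def by blast
qed

end

theorem mainTheorem7:
  fixes sc :: "'k::{real_normed_field, banach} \<Rightarrow> 'a::{real_normed_algebra, banach} \<Rightarrow> 'a"
  assumes "banach_algebra_over sc"
    and "{rmod (bidual_alg (alg_of sc)) T F | T F.
            T \<in> pts (dual (bidual_alg (alg_of sc))) \<and> F \<in> pts (bidual_alg (alg_of sc))}
         \<subseteq> canon (dual (alg_of sc)) ` pts (dual (alg_of sc))"
    and "weakly_amenable (bidual_alg (alg_of sc))"
  shows "weakly_amenable (alg_of sc)"
proof -
  interpret banach_algebra_over sc by fact
  have prod: "rmod (bidual_alg A) T F \<in> canon (dual A) ` pts (dual A)"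
    if "T \<in> pts (dual (dual (dual A)))" "F \<in> pts (dual (dual A))" for T F
    using assms(2) that by auto
  show ?thesis
    unfolding weakly_amenable_def
  proof (intro allI impI)
    fix D assume D: "derivation A D"
    then have "derivation (bidual_alg A) (second_transpose D)"
      by (rule second_transpose_derivation[OF _ prod])
    then have "inner_derivation (bidual_alg A) (second_transpose D)"
      using assms(3) by (simp add: weakly_amenable_def)
    then show "inner_derivation A D"
      using D by (intro inner_derivation_of_second_transpose) (simp_all add: derivation_def)
  qed
qed

end
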